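(* Let $x_1,y_1,z_1,x_2,y_2,z_2,s,t$ be complex numbers with $|stz_1z_2|<1$. Then \[ \sum_{m,n=0}^\infty \frac{H_{m,n}(x_1,y_1,z_1)\,H_{m,n}(x_2,y_2,z_2)}{m!\,n!}\,s^mt^n =\frac{1}{1-stz_1z_2}\exp\left(\frac{sx_1x_2+ty_1y_2+(z_1x_2y_2+z_2x_1y_1)st}{1-stz_1z_2}\right). \]
   Context: For complex numbers $x,y,z$ and non-negative integers $m,n$, the (three-variable) complex Hermite polynomials are defined by \[ H_{m,n}(x,y,z)=\sum_{k=0}^{\min\{m,n\}} k!\binom{m}{k}\binom{n}{k}x^{m-k}y^{n-k}z^k . \] *)

theory Defs
  imports "HOL-Analysis.Analysis"
begin

definition complex_hermite :: "nat \<Rightarrow> nat \<Rightarrow> complex \<Rightarrow> complex \<Rightarrow> complex \<Rightarrow> complex" where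
  "complex_hermite m n x y z =
     (\<Sum>k = 0..min m n. fact k * of_nat (m choose k) * of_nat (n choose k)
        * x ^ (m - k) * y ^ (n - k) * z ^ k)"

end

theory Submission imports Defs begin

text \<open>
  Expanding only the second Hermite polynomial and shifting $m = p + k$, $n = q + k$ turns the series into
  $\sum_k \frac{(s t z_2)^k}{k!} G_{k,k}$ with
  $G_{a,b} = \sum_{p,q} H_{p+a,q+b}(x_1,y_1,z_1) \frac{u^p v^q}{p!\,q!}$, $u = s x_2$, $v = t y_2$.
  The recurrence $H_{m+1,n} = x H_{m,n} + n z H_{m,n-1}$ passes to $G$ with $x$ replaced by $x + v z$, so that
  $G_{a,b} = H_{a,b}(x + v z, y + u z, z)\, e^{u x + v y + u v z}$. What remains is the diagonal generating function
  $\sum_k \frac{c^k}{k!} H_{k,k}(x,y,z) = \frac{1}{1 - c z} e^{c x y / (1 - c z)}$, which follows from the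
  negative binomial series. All rearrangements are justified by replacing each parameter by its modulus:
  this dominates the terms, and the same evaluations show that the dominating series converges.
\<close>

section \<open>Summation tools: dominated double sums, exponential and negative binomial
  series\<close>

text \<open>Since the terms \<open>Re (g p)\<close> are nonnegative, their convergent iterated sum
  gives summability on the product, hence absolute summability of \<open>f\<close>; then the
  iterated sum of \<open>f\<close> is its sum. In every use \<open>g\<close> is \<open>f\<close>
  with the parameters replaced by their moduli, so one evaluation supplies both \<open>F\<close> and
  \<open>G\<close>.\<close>

lemma has_sum_nested:
  fixes f g :: "'a \<times> 'b \<Rightarrow> complex"
  assumes f: "\<And>x. ((\<lambda>y. f (x, y)) has_sum F x) UNIV"
    and F: "(F has_sum S) UNIV"
    and g: "\<And>x. ((\<lambda>y. g (x, y)) has_sum G x) UNIV"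
    and G: "(G has_sum T) UNIV"
    and le: "\<And>x y. norm (f (x, y)) \<le> Re (g (x, y))"
  shows "(f has_sum S) UNIV"
proof -
  have "(\<lambda>p. Re (g p)) summable_on (UNIV \<times> UNIV)"
  proof (rule summable_on_SigmaI)
    show "((\<lambda>y. Re (g (x, y))) has_sum Re (G x)) UNIV" for x
      by (rule has_sum_Re) (rule g)
    show "(\<lambda>x. Re (G x)) summable_on UNIV"
      using has_sum_Re[OF G] by (auto simp: summable_on_def)
    show "0 \<le> Re (g (x, y))" for x y
      using le[of x y] norm_ge_zero order_trans by blast
  qed
  then have "(\<lambda>p. norm (f p)) summable_on (UNIV \<times> UNIV)"
    by (rule Infinite_Sum.abs_summable_on_comparison_test') (auto simp: le)
  then have "f summable_on (UNIV \<times> UNIV)"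
    by (rule abs_summable_summable)
  then have "(f has_sum S) (UNIV \<times> UNIV)"
    by (intro has_sum_SigmaI[where g = F] f F)
  then show ?thesis by simp
qed

lemma has_sum_exp:
  fixes x :: complex
  shows "((\<lambda>n. x ^ n / fact n) has_sum exp x) UNIV"
proof (rule norm_summable_imp_has_sum)
  show "summable (\<lambda>n. norm (x ^ n / fact n))"
    using summable_norm_exp[of x] by (simp add: scaleR_conv_of_real divide_inverse mult.commute norm_mult)
  show "(\<lambda>n. x ^ n / fact n) sums exp x"
    using exp_converges[of x] by (simp add: scaleR_conv_of_real divide_inverse mult.commute)
qed

text \<open>This is the binomial series with exponent -(l+1). Evaluating it at |w| as well gives
  absolute convergence.\<close>

lemma has_sum_negative_binomial:
  fixes w :: complex
  assumes "norm w < 1"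
  shows "((\<lambda>i. of_nat ((i + l) choose i) * w ^ i) has_sum 1 / (1 - w) ^ Suc l) UNIV"
proof -
  \<comment> \<open>The sign (-1)^i from negating the upper index cancels the one in (-v)^i.\<close>
  have coeff: "(- of_nat (Suc l) gchoose i) * (- v) ^ i = of_nat ((i + l) choose i) * v ^ i"
    for i and v :: complex
  proof -
    have "of_nat (Suc l) + of_nat i - 1 = (of_nat (i + l) :: complex)" by simp
    then show ?thesis
      unfolding gbinomial_minus
      by (simp only: binomial_gbinomial[symmetric] power_minus[of v]) simp
  qed
  have S: "(\<lambda>i. of_nat ((i + l) choose i) * v ^ i) sums (1 / (1 - v) ^ Suc l)"
    if "norm v < 1" for v :: complex
  proof -
    have "1 - v \<noteq> 0" using that by auto
    then have "(1 + - v) powr (- of_nat (Suc l)) = 1 / (1 - v) ^ Suc l"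
      by (simp only: powr_minus) (simp add: powr_nat' divide_inverse del: of_nat_Suc power_Suc)
    then show ?thesis
      using gen_binomial_complex[of "- v" "- of_nat (Suc l)"] that
      by (simp only: coeff norm_minus_cancel)
  qed
  have "summable (\<lambda>i. Re (of_nat ((i + l) choose i) * of_real (norm w) ^ i))"
    using S[of "of_real (norm w)"] assms by (intro summable_Re) (auto simp: sums_iff)
  then have "summable (\<lambda>i. norm (of_nat ((i + l) choose i) * w ^ i))"
    by (simp add: norm_mult norm_power flip: of_real_power)
  then show ?thesis
    using S[OF assms] by (rule norm_summable_imp_has_sum)
qed

section \<open>Algebra and bounds for the Hermite polynomials\<close>

lemma complex_hermite_sym: "complex_hermite m n x y z = complex_hermite n m y x z"
  by (simp add: complex_hermite_def min.commute mult_ac)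

lemma complex_hermite_0_left [simp]: "complex_hermite 0 n x y z = y ^ n"
  by (simp add: complex_hermite_def)

lemma complex_hermite_0_right [simp]: "complex_hermite m 0 x y z = x ^ m"
  by (simp add: complex_hermite_def)

text \<open>The added terms contain a vanishing binomial coefficient. A free upper limit lets
  polynomials of different degrees be compared term by term.\<close>

lemma complex_hermite_extend:
  assumes "m \<le> N \<or> n \<le> N"
  shows "complex_hermite m n x y z =
     (\<Sum>k\<le>N. fact k * of_nat (m choose k) * of_nat (n choose k)
        * x ^ (m - k) * y ^ (n - k) * z ^ k)"
  unfolding complex_hermite_def
  by (rule sum.mono_neutral_left) (use assms in \<open>auto simp: min_def not_le split: if_splits\<close>)

text \<open>Pascal's rule splits binom(m+1, k+1); the binom(m, k) part is absorbed by (k+1) binom(n,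
  k+1) = n binom(n-1, k). For n = 0 the truncated \<open>n - 1\<close> is harmless because of the
  factor n.\<close>

lemma complex_hermite_Suc_left:
  "complex_hermite (Suc m) n x y z =
     x * complex_hermite m n x y z + of_nat n * z * complex_hermite m (n - 1) x y z"
proof (cases n)
  case (Suc n')
  let ?t = "\<lambda>m n k. fact k * of_nat (m choose k) * of_nat (n choose k)
        * x ^ (m - k) * y ^ (n - k) * z ^ k"
  have split: "?t (Suc m) n (Suc k) = x * ?t m n (Suc k) + of_nat n * z * ?t m n' k" for k
  proof -
    have absorb: "of_nat (Suc k) * of_nat (n choose Suc k) = (of_nat n * of_nat (n' choose k) :: complex)"
      unfolding Suc using Suc_times_binomial[of k n'] by (metis of_nat_mult)
    \<comment> \<open>For k >= m the exponents truncate and the powers may differ, but then the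
      binomial coefficient is zero.\<close>
    have shift: "of_nat (m choose Suc k) * x ^ (m - k) = of_nat (m choose Suc k) * (x * x ^ (m - Suc k))"
    proof (cases "Suc k \<le> m")
      case True
      then have "m - k = Suc (m - Suc k)" by simp
      then show ?thesis by simp
    qed simp
    have "?t (Suc m) n (Suc k)
        = fact (Suc k) * of_nat (n choose Suc k) * y ^ (n - Suc k) * z ^ Suc k
            * (of_nat (m choose Suc k) * x ^ (m - k))
          + (of_nat (Suc k) * of_nat (n choose Suc k)) * fact k * of_nat (m choose k) * x ^ (m - k)
            * y ^ (n - Suc k) * z ^ Suc k"
      by (simp add: algebra_simps del: of_nat_Suc)
    also have "\<dots> = x * ?t m n (Suc k) + of_nat n * z * ?t m n' k"
      unfolding absorb shift by (simp add: Suc algebra_simps)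
    finally show ?thesis .
  qed
  have "complex_hermite (Suc m) n x y z = (\<Sum>k\<le>Suc n'. ?t (Suc m) n k)"
    by (rule complex_hermite_extend) (simp add: Suc)
  also have "\<dots> = x * (\<Sum>k\<le>Suc n'. ?t m n k) + of_nat n * z * (\<Sum>k\<le>n'. ?t m n' k)"
    unfolding sum.atMost_Suc_shift split
    by (simp add: sum.distrib sum_distrib_left algebra_simps)
  also have "(\<Sum>k\<le>Suc n'. ?t m n k) = complex_hermite m n x y z"
    by (rule complex_hermite_extend[symmetric]) (simp add: Suc)
  also have "(\<Sum>k\<le>n'. ?t m n' k) = complex_hermite m n' x y z"
    by (rule complex_hermite_extend[symmetric]) simp
  finally show ?thesis by (simp add: Suc)
qed simp

lemma norm_complex_hermite_le:
  "norm (complex_hermite m n x y z)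
     \<le> Re (complex_hermite m n (of_real (norm x)) (of_real (norm y)) (of_real (norm z)))"
proof -
  have "complex_hermite m n (of_real (norm x)) (of_real (norm y)) (of_real (norm z)) =
      of_real (\<Sum>k = 0..min m n. norm (fact k * of_nat (m choose k) * of_nat (n choose k)
        * x ^ (m - k) * y ^ (n - k) * z ^ k))"
    by (simp add: complex_hermite_def norm_mult norm_power)
  then show ?thesis
    by (simp only: Re_complex_of_real) (simp only: complex_hermite_def norm_sum)
qed

text \<open>\<open>Re\<close> commutes with multiplication by real numbers only, so a bound by
  \<open>Re\<close> can be carried through products once the majorant is known to be real.\<close>

lemma complex_hermite_of_real:
  "complex_hermite m n (of_real x) (of_real y) (of_real z) \<in> \<real>"
  unfolding complex_hermite_def by (intro sum_in_Reals Reals_mult Reals_power fact_in_Reals) auto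

section \<open>The shifted exponential generating functions G_{a,b}\<close>

text \<open>These are the terms of the mixed derivative of order a in u and b in v of exp(ux + vy +
  uvz).\<close>

definition hermite_shift_term ::
    "nat \<Rightarrow> nat \<Rightarrow> complex \<Rightarrow> complex \<Rightarrow> complex \<Rightarrow> complex \<Rightarrow> complex \<Rightarrow> nat \<times> nat \<Rightarrow> complex" where
  "hermite_shift_term a b x y z u v =
     (\<lambda>(p, q). complex_hermite (p + a) (q + b) x y z * u ^ p * v ^ q / (fact p * fact q))"

lemma norm_hermite_shift_term_le:
  "norm (hermite_shift_term a b x y z u v r)
     \<le> Re (hermite_shift_term a b (of_real (norm x)) (of_real (norm y)) (of_real (norm z))
             (of_real (norm u)) (of_real (norm v)) r)"
proof -
  obtain p q where r: "r = (p, q)" by force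
  obtain h where h: "complex_hermite (p + a) (q + b) (of_real (norm x)) (of_real (norm y)) (of_real (norm z)) = of_real h"
    using complex_hermite_of_real Reals_cases by metis
  have "norm (complex_hermite (p + a) (q + b) x y z) \<le> h"
    using norm_complex_hermite_le[of "p + a" "q + b" x y z] by (simp add: h)
  then have "norm (complex_hermite (p + a) (q + b) x y z) * (norm u ^ p * norm v ^ q / (fact p * fact q))
      \<le> h * (norm u ^ p * norm v ^ q / (fact p * fact q))"
    by (intro mult_right_mono) auto
  moreover have "hermite_shift_term a b (of_real (norm x)) (of_real (norm y)) (of_real (norm z))
             (of_real (norm u)) (of_real (norm v)) r = of_real (h * (norm u ^ p * norm v ^ q / (fact p * fact q)))"
    by (simp add: hermite_shift_term_def r h)
  moreover have "norm (hermite_shift_term a b x y z u v r)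
      = norm (complex_hermite (p + a) (q + b) x y z) * (norm u ^ p * norm v ^ q / (fact p * fact q))"
    by (simp add: hermite_shift_term_def r norm_mult norm_divide norm_power)
  ultimately show ?thesis
    by (simp only: Re_complex_of_real)
qed

lemma has_sum_hermite_shift_swap:
  "(hermite_shift_term a b x y z u v has_sum S) UNIV \<longleftrightarrow>
   (hermite_shift_term b a y x z v u has_sum S) UNIV"
  by (rule has_sum_reindex_bij_witness[of _ "\<lambda>(p, q). (q, p)" "\<lambda>(p, q). (q, p)"])
    (auto simp: hermite_shift_term_def complex_hermite_sym[of _ _ x y] mult_ac)

text \<open>With p = i + k and q = j + k the expanded summand factors into (ux)^i/i!, (vy)^j/j! and
  (uvz)^k/k!, so the series is a product of three exponential series.\<close>

lemma has_sum_hermite_shift_0_0: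
  "(hermite_shift_term 0 0 x y z u v has_sum exp (u * x + v * y + u * v * z)) UNIV"
proof -
  let ?e = "\<lambda>(x::complex) n. x ^ n / fact n"
  let ?f2 = "\<lambda>a b (i, j). ?e a i * ?e b j"
  let ?f3 = "\<lambda>a b c (k, r). ?e c k * ?f2 a b r"
  have two: "(?f2 a b has_sum exp a * exp b) UNIV" for a b
  proof -
    have row: "((\<lambda>j. ?f2 a b (i, j)) has_sum ?e a i * exp b) UNIV" for a b i
      using has_sum_cmult_right[OF has_sum_exp, of "?e a i" b] by simp
    have col: "((\<lambda>i. ?e a i * exp b) has_sum exp a * exp b) UNIV" for a b
      using has_sum_cmult_left[OF has_sum_exp, of a "exp b"] by simp
    \<comment> \<open>At the moduli each term equals the norm of the original term, so the
      domination holds with equality.\<close>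
    have "?f2 (of_real (norm a)) (of_real (norm b)) (i, j) = of_real (norm (?f2 a b (i, j)))" for i j
      by (simp add: norm_mult norm_divide norm_power)
    then show ?thesis
      by (intro has_sum_nested[where g = "?f2 (of_real (norm a)) (of_real (norm b))", OF row col row col])
        (simp only: Re_complex_of_real order_refl)
  qed
  have three: "(?f3 a b c has_sum exp c * (exp a * exp b)) UNIV" for a b c
  proof -
    have row: "((\<lambda>r. ?f3 a b c (k, r)) has_sum ?e c k * (exp a * exp b)) UNIV" for a b c k
      using has_sum_cmult_right[OF two, of "?e c k" a b] by simp
    have col: "((\<lambda>k. ?e c k * (exp a * exp b)) has_sum exp c * (exp a * exp b)) UNIV" for a b c
      using has_sum_cmult_left[OF has_sum_exp, of c "exp a * exp b"] by simp
    have "?f3 (of_real (norm a)) (of_real (norm b)) (of_real (norm c)) (k, r)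
        = of_real (norm (?f3 a b c (k, r)))" for k r
      by (simp add: case_prod_unfold norm_mult norm_divide norm_power)
    then show ?thesis
      by (intro has_sum_nested[where g = "?f3 (of_real (norm a)) (of_real (norm b)) (of_real (norm c))",
            OF row col row col])
        (simp only: Re_complex_of_real order_refl)
  qed
  \<comment> \<open>The triples (k, (i, j)) correspond to pairs (p, q) with a k <= min p q; the
    finite inner sum over k then restores the Hermite polynomial.\<close>
  let ?g = "\<lambda>((p, q), k). ?f3 (u * x) (v * y) (u * v * z) (k, (p - k, q - k))"
  have "(?g has_sum exp (u * v * z) * (exp (u * x) * exp (v * y))) (Sigma UNIV (\<lambda>(p, q). {0..min p q}))"
    using three[where a = "u * x" and b = "v * y" and c = "u * v * z"]
    by (subst has_sum_reindex_bij_witness[where T = UNIV and h = "?f3 (u * x) (v * y) (u * v * z)"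
          and j = "\<lambda>((p, q), k). (k, (p - k, q - k))" and i = "\<lambda>(k, (i, j)). ((i + k, j + k), k)"])
      auto
  then have "(hermite_shift_term 0 0 x y z u v has_sum exp (u * v * z) * (exp (u * x) * exp (v * y))) UNIV"
  proof (rule has_sum_SigmaD)
    fix r :: "nat \<times> nat"
    obtain p q where r: "r = (p, q)" by force
    have "hermite_shift_term 0 0 x y z u v r = (\<Sum>k = 0..min p q. ?g (r, k))"
      unfolding hermite_shift_term_def complex_hermite_def r prod.case add_0_right sum_distrib_right sum_divide_distrib
    proof (rule sum.cong[OF refl])
      fix k assume "k \<in> {0..min p q}"
      then obtain i j where "p = i + k" "q = j + k"
        by (metis add.commute atLeastAtMost_iff le_Suc_ex min.bounded_iff)
      then show "fact k * of_nat (p choose k) * of_nat (q choose k) * x ^ (p - k) *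
          y ^ (q - k) * z ^ k * u ^ p * v ^ q / (fact p * fact q) =
          ?e (u * v * z) k * (?e (u * x) (p - k) * ?e (v * y) (q - k))"
        by (simp add: binomial_fact power_mult_distrib power_add field_simps)
    qed
    then show "((\<lambda>k. ?g (r, k)) has_sum hermite_shift_term 0 0 x y z u v r)
        (case r of (p, q) \<Rightarrow> {0..min p q})"
      by (simp add: r has_sum_finite_iff)
  qed
  then show ?thesis by (simp add: exp_add mult_ac)
qed

text \<open>The recurrence brings in the factor q + b. Its q part cancels against q!, and shifting q
  gives v z times the original series, so x becomes x + v z; its b part gives the series with b -
  1.\<close>

lemma has_sum_hermite_shift_Suc:
  assumes S: "(hermite_shift_term a b x y z u v has_sum S) UNIV"
    and R: "(hermite_shift_term a (b - 1) x y z u v has_sum R) UNIV"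
  shows "(hermite_shift_term (Suc a) b x y z u v has_sum (x + v * z) * S + of_nat b * z * R) UNIV"
proof -
  let ?T = "\<lambda>b. hermite_shift_term a b x y z u v"
  \<comment> \<open>At q = 0 the factor q removes the term, whatever the truncated index
    \<open>q + b - 1\<close> is.\<close>
  define d where "d = (\<lambda>(p, q). of_nat q *
    (complex_hermite (p + a) (q + b - 1) x y z * u ^ p * v ^ q / (fact p * fact q)))"
  have "((\<lambda>r. v * ?T b r) has_sum v * S) UNIV"
    by (rule has_sum_cmult_right[OF S])
  also have "?this \<longleftrightarrow> (d has_sum v * S) {(p, q). 0 < q}"
  proof (rule has_sum_reindex_bij_witness[of _ "\<lambda>(p, q). (p, q - 1)" "\<lambda>(p, q). (p, Suc q)"])
    show "d (case r of (p, q) \<Rightarrow> (p, Suc q)) = v * ?T b r" for r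
    proof (cases r)
      case (Pair p q)
      have "(of_nat (Suc q) :: complex) \<noteq> 0" by (simp del: of_nat_Suc)
      then show ?thesis
        by (simp add: d_def hermite_shift_term_def Pair field_simps del: of_nat_Suc)
    qed
  qed auto
  also have "\<dots> \<longleftrightarrow> (d has_sum v * S) UNIV"
    by (rule has_sum_cong_neutral) (auto simp: d_def)
  finally have d: "(d has_sum v * S) UNIV" .
  have "((\<lambda>r. x * ?T b r + (z * d r + of_nat b * z * ?T (b - 1) r))
      has_sum x * S + (z * (v * S) + of_nat b * z * R)) UNIV"
    by (intro has_sum_add has_sum_cmult_right S R d)
  moreover have "hermite_shift_term (Suc a) b x y z u v =
      (\<lambda>r. x * ?T b r + (z * d r + of_nat b * z * ?T (b - 1) r))"
  proof (rule ext, clarify)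
    fix p q
    \<comment> \<open>The two indices can differ only for b = 0, where the factor b
      vanishes.\<close>
    have "of_nat b * complex_hermite (p + a) (q + b - 1) x y z
        = of_nat b * complex_hermite (p + a) (q + (b - 1)) x y z"
      by (cases b) auto
    then have "complex_hermite (p + Suc a) (q + b) x y z = x * complex_hermite (p + a) (q + b) x y z
        + (z * (of_nat q * complex_hermite (p + a) (q + b - 1) x y z)
         + z * (of_nat b * complex_hermite (p + a) (q + (b - 1)) x y z))"
      by (simp add: complex_hermite_Suc_left algebra_simps)
    then show "hermite_shift_term (Suc a) b x y z u v (p, q)
        = x * ?T b (p, q) + (z * d (p, q) + of_nat b * z * ?T (b - 1) (p, q))"
      unfolding hermite_shift_term_def d_def prod.case
      by (simp add: algebra_simps add_divide_distrib)
  qed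
  ultimately show ?thesis by (simp add: algebra_simps)
qed

text \<open>Both sides obey the same recurrence in a. Induction from G_{0,0} settles b = 0, the
  symmetry turns this into the case a = 0 for every b, and a second induction on a does the
  rest.\<close>

lemma has_sum_hermite_shift:
  "(hermite_shift_term a b x y z u v has_sum
     complex_hermite a b (x + v * z) (y + u * z) z * exp (u * x + v * y + u * v * z)) UNIV"
proof -
  have right_0: "(hermite_shift_term a 0 x y z u v has_sum
     (x + v * z) ^ a * exp (u * x + v * y + u * v * z)) UNIV" for a x y u v
  proof (induction a)
    case 0
    show ?case using has_sum_hermite_shift_0_0 by simp
  next
    case (Suc a)
    \<comment> \<open>For b = 0 also \<open>b - 1\<close> is 0, so the induction hypothesis serves
      for both sums; the second one has coefficient 0.\<close>
    show ?case using has_sum_hermite_shift_Suc[of a 0 x y z u v, simplified, OF Suc Suc] by (simp add: mult_ac)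
  qed
  show ?thesis
  proof (induction a arbitrary: b)
    case 0
    show ?case
      using right_0[of b y x v u] by (subst has_sum_hermite_shift_swap) (simp add: algebra_simps)
  next
    case (Suc a)
    show ?case
      using has_sum_hermite_shift_Suc[OF Suc Suc] by (simp add: complex_hermite_Suc_left algebra_simps)
  qed
qed

section \<open>The diagonal generating function\<close>

text \<open>With k = l + i the summand is (cxy)^l/l! binom(i+l, i) (cz)^i. Summing over i first
  gives (cxy)^l/l! / (1-cz)^(l+1), and the sum over l is exponential.\<close>

lemma has_sum_hermite_diagonal:
  fixes c :: complex
  assumes "norm (c * z) < 1"
  shows "((\<lambda>k. c ^ k / fact k * complex_hermite k k x y z) has_sum
     1 / (1 - c * z) * exp (c * x * y / (1 - c * z))) UNIV"
proof -
  define f :: "complex \<Rightarrow> complex \<Rightarrow> nat \<times> nat \<Rightarrow> complex"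
    where "f w e = (\<lambda>(l, i). e ^ l / fact l * (of_nat ((i + l) choose i) * w ^ i))" for w e
  define F :: "complex \<Rightarrow> complex \<Rightarrow> nat \<Rightarrow> complex"
    where "F w e = (\<lambda>l. e ^ l / fact l * (1 / (1 - w) ^ Suc l))" for w e
  have f: "((\<lambda>i. f w e (l, i)) has_sum F w e l) UNIV" if "norm w < 1" for w e l
    unfolding f_def F_def prod.case by (intro has_sum_cmult_right has_sum_negative_binomial that)
  have F: "(F w e has_sum 1 / (1 - w) * exp (e / (1 - w))) UNIV" for w e
    using has_sum_cmult_right[OF has_sum_exp, of "1 / (1 - w)" "e / (1 - w)"]
    by (simp add: F_def power_divide mult_ac)
  have nested: "(f w e has_sum 1 / (1 - w) * exp (e / (1 - w))) UNIV" if "norm w < 1" for w e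
  proof (rule has_sum_nested[OF f[OF that] F f F])
    show "norm (of_real (norm w) :: complex) < 1" using that by simp
    have "f (of_real (norm w)) (of_real (norm e)) (l, i) = of_real (norm (f w e (l, i)))" for l i
      by (simp add: f_def norm_mult norm_divide norm_power)
    then show "norm (f w e (l, i)) \<le> Re (f (of_real (norm w)) (of_real (norm e)) (l, i))" for l i
      by (simp only: Re_complex_of_real order_refl)
  qed
  let ?f = "f (c * z) (c * x * y)"
  have "((\<lambda>(k, i). ?f (k - i, i)) has_sum 1 / (1 - c * z) * exp (c * x * y / (1 - c * z)))
      (Sigma UNIV (\<lambda>k. {0..k}))"
    using nested[OF assms]
    by (subst has_sum_reindex_bij_witness[where T = UNIV and h = ?f
          and j = "\<lambda>(k, i). (k - i, i)" and i = "\<lambda>(l, i). (l + i, i)"]) auto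
  then show ?thesis
  proof (rule has_sum_SigmaD)
    fix k :: nat
    have "c ^ k / fact k * complex_hermite k k x y z = (\<Sum>i = 0..k. ?f (k - i, i))"
      unfolding complex_hermite_def sum_distrib_left min.idem
    proof (rule sum.cong[OF refl])
      fix i assume "i \<in> {0..k}"
      then obtain l where "k = i + l" by (auto simp: le_iff_add)
      then show "c ^ k / fact k * (fact i * of_nat (k choose i) * of_nat (k choose i) * x ^ (k - i) *
          y ^ (k - i) * z ^ i) = ?f (k - i, i)"
        by (simp add: f_def binomial_fact power_mult_distrib power_add field_simps)
    qed
    then show "((\<lambda>i. case (k, i) of (k, i) \<Rightarrow> ?f (k - i, i)) has_sum
        c ^ k / fact k * complex_hermite k k x y z) {0..k}"
      by (simp add: has_sum_finite_iff)
  qed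
qed

section \<open>Assembly of the bilinear generating function\<close>

theorem theorem3p1:
  fixes x1 y1 z1 x2 y2 z2 s t :: complex
  assumes "norm (s * t * z1 * z2) < 1"
  shows "((\<lambda>(m, n). complex_hermite m n x1 y1 z1 * complex_hermite m n x2 y2 z2
             / (fact m * fact n) * s ^ m * t ^ n)
          has_sum
          (1 / (1 - s * t * z1 * z2)
            * exp ((s * x1 * x2 + t * y1 * y2 + (z1 * x2 * y2 + z2 * x1 * y1) * (s * t))
                   / (1 - s * t * z1 * z2))))
         (UNIV :: (nat \<times> nat) set)"
proof -
  define f :: "complex \<Rightarrow> complex \<Rightarrow> complex \<Rightarrow> complex \<Rightarrow> complex \<Rightarrow> complex \<Rightarrow> nat \<times> nat \<times> nat \<Rightarrow> complex"
    where "f c x y z u v = (\<lambda>(k, r). c ^ k / fact k * hermite_shift_term k k x y z u v r)" for c x y z u v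
  define F :: "complex \<Rightarrow> complex \<Rightarrow> complex \<Rightarrow> complex \<Rightarrow> complex \<Rightarrow> complex \<Rightarrow> nat \<Rightarrow> complex"
    where "F c x y z u v = (\<lambda>k. c ^ k / fact k *
      (complex_hermite k k (x + v * z) (y + u * z) z * exp (u * x + v * y + u * v * z)))" for c x y z u v
  define S :: "complex \<Rightarrow> complex \<Rightarrow> complex \<Rightarrow> complex \<Rightarrow> complex \<Rightarrow> complex \<Rightarrow> complex"
    where "S c x y z u v = 1 / (1 - c * z) * exp (c * (x + v * z) * (y + u * z) / (1 - c * z))
      * exp (u * x + v * y + u * v * z)" for c x y z u v
  have f: "((\<lambda>r. f c x y z u v (k, r)) has_sum F c x y z u v k) UNIV" for c x y z u v k
    unfolding f_def F_def prod.case by (intro has_sum_cmult_right has_sum_hermite_shift)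
  have F: "(F c x y z u v has_sum S c x y z u v) UNIV" if "norm (c * z) < 1" for c x y z u v
    using has_sum_cmult_left[OF has_sum_hermite_diagonal[OF that]]
    by (simp add: F_def S_def mult.assoc)
  \<comment> \<open>The condition on c z depends on moduli only, so it passes to the majorant and
    the same closed form applies there.\<close>
  have nested: "(f c x y z u v has_sum S c x y z u v) UNIV" if "norm (c * z) < 1" for c x y z u v
  proof (rule has_sum_nested[where g = "f (of_real (norm c)) (of_real (norm x)) (of_real (norm y))
        (of_real (norm z)) (of_real (norm u)) (of_real (norm v))", OF f F[OF that] f F])
    show "norm (of_real (norm c) * of_real (norm z) :: complex) < 1" using that by (simp add: norm_mult)
    show "norm (f c x y z u v (k, r)) \<le> Re (f (of_real (norm c)) (of_real (norm x)) (of_real (norm y))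
        (of_real (norm z)) (of_real (norm u)) (of_real (norm v)) (k, r))" for k r
    proof -
      have eq: "of_real (norm c) ^ k / fact k = (of_real (norm (c ^ k / fact k)) :: complex)"
        by (simp add: norm_divide norm_power)
      have Re_mult: "Re (of_real a * w) = a * Re w" for a w by simp
      show ?thesis
        unfolding f_def prod.case eq norm_mult Re_mult
        by (intro mult_left_mono norm_hermite_shift_term_le) simp
    qed
  qed
  let ?f = "f (s * t * z2) x1 y1 z1 (s * x2) (t * y2)"
  let ?g = "\<lambda>((m, n), k). ?f (k, (m - k, n - k))"
  let ?S = "1 / (1 - s * t * z1 * z2)
            * exp ((s * x1 * x2 + t * y1 * y2 + (z1 * x2 * y2 + z2 * x1 * y1) * (s * t))
                   / (1 - s * t * z1 * z2))"
  have nz: "1 - s * t * z1 * z2 \<noteq> 0" using assms by auto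
  have w: "s * t * z2 * z1 = s * t * z1 * z2" by simp
  \<comment> \<open>With c = s t z2, u = s x2, v = t y2 and z = z1, over the denominator 1 - cz the
    terms c u x z, c v y z and c u v z^2 cancel, leaving cxy + ux + vy + uvz.\<close>
  have "(s * t * z2) * (x1 + t * y2 * z1) * (y1 + s * x2 * z1) / (1 - s * t * z1 * z2)
      + (s * x2 * x1 + t * y2 * y1 + s * x2 * (t * y2) * z1)
    = (s * x1 * x2 + t * y1 * y2 + (z1 * x2 * y2 + z2 * x1 * y1) * (s * t)) / (1 - s * t * z1 * z2)"
    using nz by (simp add: divide_simps) algebra
  then have "S (s * t * z2) x1 y1 z1 (s * x2) (t * y2) = ?S"
    unfolding S_def w mult.assoc[of "1 / (1 - s * t * z1 * z2)"] exp_add[symmetric] by simp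
  then have "(?f has_sum ?S) UNIV"
    using nested[of "s * t * z2" z1] assms by (metis w)
  \<comment> \<open>Regrouping by m = p + k, n = q + k makes the inner sum over k finite; it is the
    expansion of the second Hermite polynomial.\<close>
  then have "(?g has_sum ?S) (Sigma UNIV (\<lambda>(m, n). {0..min m n}))"
    by (subst has_sum_reindex_bij_witness[where T = UNIV and h = ?f
          and j = "\<lambda>((m, n), k). (k, (m - k, n - k))" and i = "\<lambda>(k, (p, q)). ((p + k, q + k), k)"])
      auto
  then show ?thesis
  proof (rule has_sum_SigmaD)
    fix r :: "nat \<times> nat"
    obtain m n where r: "r = (m, n)" by force
    have "complex_hermite m n x1 y1 z1 * complex_hermite m n x2 y2 z2 / (fact m * fact n) * s ^ m * t ^ n
        = (\<Sum>k = 0..min m n. ?g (r, k))"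
      unfolding r prod.case complex_hermite_def[of m n x2] sum_distrib_left sum_distrib_right sum_divide_distrib
    proof (rule sum.cong[OF refl])
      fix k assume "k \<in> {0..min m n}"
      then obtain p q where "m = p + k" "n = q + k"
        by (metis add.commute atLeastAtMost_iff le_Suc_ex min.bounded_iff)
      then show "complex_hermite m n x1 y1 z1 * (fact k * of_nat (m choose k) * of_nat (n choose k) *
          x2 ^ (m - k) * y2 ^ (n - k) * z2 ^ k) / (fact m * fact n) * s ^ m * t ^ n
          = ?f (k, (m - k, n - k))"
        by (simp add: f_def hermite_shift_term_def binomial_fact power_mult_distrib power_add field_simps)
    qed
    then show "((\<lambda>k. ?g (r, k)) has_sum
        (case r of (m, n) \<Rightarrow> complex_hermite m n x1 y1 z1 * complex_hermite m n x2 y2 z2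
             / (fact m * fact n) * s ^ m * t ^ n)) (case r of (m, n) \<Rightarrow> {0..min m n})"
      by (simp add: r has_sum_finite_iff)
  qed
qed

end
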